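(* Let $m,n$ be positive integers. Every arithmetical structure on $\mathcal{P}_{m,n}$ has a unique ancestor which is a smooth arithmetical structure on some $\mathcal{P}_{m',n'}$ (with $1\le m'\le m$, $1\le n'\le n$). Moreover, for every $1\le m'\le m$, $1\le n'\le n$ and every smooth arithmetical structure $S$ on $\mathcal{P}_{m',n'}$, there are exactly $C(m,m')\,C(n,n')$ arithmetical structures on $\mathcal{P}_{m,n}$ having $S$ as an ancestor, where $C(n,k)=\frac{k}{n}\binom{2n-k-1}{n-1}$.
   Context: For positive integers $m,n$, the multigraph $\mathcal{P}_{m,n}$ has vertices $a_1,\ldots,a_m,b_1,\ldots,b_n$, a single edge between $a_i$ and $a_{i+1}$ for $1\le i<m$, a single edge between $b_i$ and $b_{i+1}$ for $1\le i<n$, and two parallel edges between $a_1$ and $b_1$. An arithmetical structure is an assignment of a positive integer label to each vertex such that the labels have gcd $1$ and each vertex's label divides the sum of its neighbors' labels counted with edge multiplicity; we write $a_i,b_i$ also for the labels. A structure is smooth if $a_1>a_2>\cdots>a_m$ and $b_1>b_2>\cdots>b_n$. Smoothing operations: (1) if $n\ge 2$ and $b_n=b_{n-1}$, delete $b_n$, obtaining a structure on $\mathcal{P}_{m,n-1}$ with other labels unchanged; (2) if $b_i=b_{i-1}+b_{i+1}$ for some $2\le i\le n-1$, delete $b_i$ and reindex $b_{i+1},\ldots,b_n$ as $b_i,\ldots,b_{n-1}$, obtaining a structure on $\mathcal{P}_{m,n-1}$; and the analogous two operations on the $a_i$. A structure $T'$ on $\mathcal{P}_{m',n'}$ is an ancestor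 of a structure $T$ on $\mathcal{P}_{m,n}$ if $T'$ is obtained from $T$ by a finite (possibly empty) sequence of smoothing operations. *)

theory Defs
  imports Complex_Main
begin

text \<open>A loopless multigraph is given by its vertex set and its (symmetric) edge multiplicities;
  \<open>mult G v w\<close> is only meaningful for vertices \<open>v\<close>, \<open>w\<close> of \<open>G\<close>.\<close>

record 'v multigraph =
  verts :: "'v set"
  mult :: "'v \<Rightarrow> 'v \<Rightarrow> nat"

definition arithmetical_structure :: "'v multigraph \<Rightarrow> ('v \<Rightarrow> nat) \<Rightarrow> bool" where
  "arithmetical_structure G r \<longleftrightarrow>
     (\<forall>v\<in>verts G. r v > 0) \<and>
     Gcd (r ` verts G) = 1 \<and>
     (\<forall>v\<in>verts G. r v dvd (\<Sum>w\<in>verts G. mult G v w * r w))"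

datatype vertex = A nat | B nat

fun P_mult :: "vertex \<Rightarrow> vertex \<Rightarrow> nat" where
  "P_mult (A i) (A j) = (if j = i + 1 \<or> i = j + 1 then 1 else 0)"
| "P_mult (B i) (B j) = (if j = i + 1 \<or> i = j + 1 then 1 else 0)"
| "P_mult (A i) (B j) = (if i = 1 \<and> j = 1 then 2 else 0)"
| "P_mult (B i) (A j) = (if i = 1 \<and> j = 1 then 2 else 0)"

definition P_graph :: "nat \<Rightarrow> nat \<Rightarrow> vertex multigraph" where
  "P_graph m n = \<lparr> verts = A ` {1..m} \<union> B ` {1..n}, mult = P_mult \<rparr>"

text \<open>A labelling of \<open>P_graph m n\<close> is stored as the pair of lists
  \<open>([a\<^sub>1, \<dots>, a\<^sub>m], [b\<^sub>1, \<dots>, b\<^sub>n])\<close>, so that labellings of graphs of different sizes have the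
  same type and a labelling is determined by its values on the vertices.
  Vertices are numbered from 1, list positions from 0.\<close>

type_synonym labelling = "nat list \<times> nat list"

fun label :: "labelling \<Rightarrow> vertex \<Rightarrow> nat" where
  "label (as, bs) (A i) = as ! (i - 1)"
| "label (as, bs) (B i) = bs ! (i - 1)"

definition P_structure :: "nat \<Rightarrow> nat \<Rightarrow> labelling \<Rightarrow> bool" where
  "P_structure m n T \<longleftrightarrow>
     length (fst T) = m \<and> length (snd T) = n \<and>
     arithmetical_structure (P_graph m n) (label T)"

definition smooth :: "labelling \<Rightarrow> bool" where
  "smooth T \<longleftrightarrow> sorted_wrt (>) (fst T) \<and> sorted_wrt (>) (snd T)"

text \<open>The two smoothing operations, on the label sequence of one of the two paths. The first
  label of a sequence is never deleted.\<close>

inductive smooth_path :: "nat list \<Rightarrow> nat list \<Rightarrow> bool" where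
  last: "smooth_path (xs @ [c, c]) (xs @ [c])"
| inner: "b = a + c \<Longrightarrow> smooth_path (xs @ [a, b, c] @ ys) (xs @ [a, c] @ ys)"

inductive smoothing :: "labelling \<Rightarrow> labelling \<Rightarrow> bool" where
  "smooth_path as as' \<Longrightarrow> smoothing (as, bs) (as', bs)"
| "smooth_path bs bs' \<Longrightarrow> smoothing (as, bs) (as, bs')"

definition ancestor :: "labelling \<Rightarrow> labelling \<Rightarrow> bool" where
  "ancestor T' T \<longleftrightarrow> smoothing\<^sup>*\<^sup>* T T'"

definition C :: "nat \<Rightarrow> nat \<Rightarrow> real" where
  "C n k = real k / real n * real ((2 * n - k - 1) choose (n - 1))"

end

(* Think of each path as continued by a label 0. Both smoothing operations then delete an entry
   that is the sum of its two neighbours, so reversing them inserts the sum of two adjacent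
   entries. Deleting such entries from right to left by means of a stack computes a list that is
   invariant under smoothing and fixes strictly decreasing lists; for a structure the
   divisibility conditions make it strictly decreasing, which gives existence and uniqueness of
   the smooth ancestor. For the count, the lists of length n that smooth to s # S either start
   with s followed by a list that smooths to S, or smooth to s # (s + t) # S, where t is the first
   entry of S followed by 0, and not both. Hence their number depends only on n and the length k
   of the target and satisfies the ballot recurrence C(n,k) = C(n-1,k-1) + C(n,k+1). *)
theory Submission
  imports Defs
begin

section \<open>Structures as conditions on two lists\<close>

fun hd0 :: "nat list \<Rightarrow> nat" where
  "hd0 [] = 0"
| "hd0 (x # xs) = x"

text \<open>The divisibility conditions along one path: \<open>p\<close> is what the first entry
  receives from outside its path, and every later entry receives its predecessor in that place. In a
  structure the double edge makes \<open>p\<close> twice the first label of the other path.\<close>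

fun path_ok :: "nat \<Rightarrow> nat list \<Rightarrow> bool" where
  "path_ok p [] \<longleftrightarrow> True"
| "path_ok p (x # xs) \<longleftrightarrow> x dvd p + hd0 xs \<and> path_ok x xs"

lemma hd0_append: "hd0 (xs @ ys) = (if xs = [] then hd0 ys else hd0 xs)"
  by (cases xs) auto

lemma hd0_conv_nth: "hd0 xs = (if 0 < length xs then xs ! 0 else 0)"
  by (cases xs) auto

lemma path_ok_conv_nth:
  "path_ok p xs \<longleftrightarrow>
     (\<forall>i<length xs. xs ! i dvd (if i = 0 then p else xs ! (i - 1)) +
                             (if Suc i < length xs then xs ! Suc i else 0))"
proof (induction p xs rule: path_ok.induct)
  case (2 p x xs)
  show ?case
    unfolding path_ok.simps 2 hd0_conv_nth length_Cons All_less_Suc2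
    by (auto simp: nth_Cons' split: if_splits)
qed simp

lemma path_sum:
  fixes xs :: "nat list"
  assumes "i \<in> {1..length xs}"
  shows "(\<Sum>j=1..length xs. (if j = Suc i \<or> i = Suc j then 1 else 0) * xs ! (j - 1)) =
         (if i = 1 then 0 else xs ! (i - 2)) + (if i < length xs then xs ! i else 0)"
proof -
  \<comment> \<open>For \<open>i = 1\<close> the left neighbour would be \<open>j = 0\<close>, which
    lies outside the range of summation, so the second sum vanishes.\<close>
  have "(\<Sum>j=1..length xs. (if j = Suc i \<or> i = Suc j then 1 else 0) * xs ! (j - 1)) =
        (\<Sum>j=1..length xs. (if j = Suc i then xs ! (j - 1) else 0)) +
        (\<Sum>j=1..length xs. (if j = i - 1 then xs ! (j - 1) else 0))"
    unfolding sum.distrib[symmetric] by (intro sum.cong) auto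
  also have "\<dots> = (if i < length xs then xs ! i else 0) + (if i = 1 then 0 else xs ! (i - 2))"
    using assms by (auto simp: sum.delta numeral_2_eq_2)
  finally show ?thesis by simp
qed

lemma first_sum:
  fixes xs :: "nat list"
  shows "(\<Sum>j=1..length xs. (if i = Suc 0 \<and> j = Suc 0 then 2 else 0) * xs ! (j - 1)) =
         (if i = 1 then 2 * hd0 xs else 0)"
proof -
  have "(\<Sum>j=1..length xs. (if i = Suc 0 \<and> j = Suc 0 then 2 else 0) * xs ! (j - 1)) =
        (\<Sum>j=1..length xs. if j = 1 then (if i = 1 then 2 * xs ! 0 else 0) else 0)"
    by (intro sum.cong) auto
  also have "\<dots> = (if i = 1 then 2 * hd0 xs else 0)"
    by (auto simp: sum.delta hd0_conv_nth not_less_eq_eq)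
  finally show ?thesis .
qed

lemma sum_verts_P_graph:
  "(\<Sum>w\<in>A ` {1..m} \<union> B ` {1..n}. f w) = (\<Sum>j=1..m. f (A j)) + (\<Sum>j=1..n. f (B j))"
  by (subst sum.union_disjoint) (auto simp: sum.reindex inj_on_def)

lemma nth_image_1: "(\<lambda>i. xs ! (i - 1)) ` {1..length xs} = set xs"
proof -
  have "(\<lambda>i. xs ! (i - 1)) ` Suc ` {..<length xs} = set xs"
    unfolding image_image set_conv_nth by auto
  then show ?thesis
    by (simp only: image_Suc_lessThan)
qed

lemma Ball_1_length:
  "(\<forall>i\<in>{1..length xs}. P i) \<longleftrightarrow> (\<forall>i<length xs. P (Suc i))"
  unfolding image_Suc_lessThan[symmetric] by auto

lemma path_ok_vertices:
  "path_ok (2 * hd0 ys) xs \<longleftrightarrow>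
     (\<forall>i\<in>{1..length xs}. xs ! (i - 1) dvd
        (\<Sum>j=1..length xs. (if j = Suc i \<or> i = Suc j then 1 else 0) * xs ! (j - 1)) +
        (\<Sum>j=1..length ys. (if i = Suc 0 \<and> j = Suc 0 then 2 else 0) * ys ! (j - 1)))"
proof -
  have "path_ok (2 * hd0 ys) xs \<longleftrightarrow>
     (\<forall>i\<in>{1..length xs}. xs ! (i - 1) dvd
        ((if i = 1 then 0 else xs ! (i - 2)) + (if i < length xs then xs ! i else 0)) +
        (if i = 1 then 2 * hd0 ys else 0))"
    unfolding Ball_1_length path_ok_conv_nth
    by (intro all_cong) (auto simp: add.commute numeral_2_eq_2)
  also have "\<dots> \<longleftrightarrow> (\<forall>i\<in>{1..length xs}. xs ! (i - 1) dvd
        (\<Sum>j=1..length xs. (if j = Suc i \<or> i = Suc j then 1 else 0) * xs ! (j - 1)) +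
        (\<Sum>j=1..length ys. (if i = Suc 0 \<and> j = Suc 0 then 2 else 0) * ys ! (j - 1)))"
    by (intro ball_cong refl) (simp only: path_sum first_sum)
  finally show ?thesis .
qed

text \<open>The paths meet only in the double edge between their first vertices, so the conditions
  split into one per path, linked by the two first labels and the gcd. All later arguments use this
  form.\<close>

lemma P_structure_iff:
  "P_structure m n (as, bs) \<longleftrightarrow>
     length as = m \<and> length bs = n \<and> 0 \<notin> set as \<and> 0 \<notin> set bs \<and>
     Gcd (set as \<union> set bs) = 1 \<and> path_ok (2 * hd0 bs) as \<and> path_ok (2 * hd0 as) bs"
proof -
  have img: "label (as, bs) ` (A ` {1..length as} \<union> B ` {1..length bs}) = set as \<union> set bs"
    unfolding image_Un image_image label.simps nth_image_1 ..
  have "(\<forall>v\<in>A ` {1..length as} \<union> B ` {1..length bs}. 0 < label (as, bs) v) \<longleftrightarrow>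
        0 \<notin> label (as, bs) ` (A ` {1..length as} \<union> B ` {1..length bs})"
    by (auto simp: image_iff)
  then have pos: "(\<forall>v\<in>A ` {1..length as} \<union> B ` {1..length bs}. 0 < label (as, bs) v) \<longleftrightarrow>
        0 \<notin> set as \<and> 0 \<notin> set bs"
    unfolding img by simp
  have dvd: "(\<forall>v\<in>A ` {1..length as} \<union> B ` {1..length bs}. label (as, bs) v dvd
          (\<Sum>w\<in>A ` {1..length as} \<union> B ` {1..length bs}. P_mult v w * label (as, bs) w)) \<longleftrightarrow>
        path_ok (2 * hd0 bs) as \<and> path_ok (2 * hd0 as) bs"
    unfolding path_ok_vertices ball_Un ball_simps sum_verts_P_graph
    by (simp add: add.commute conj_commute)
  have "P_structure (length as) (length bs) (as, bs) \<longleftrightarrow>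
      0 \<notin> set as \<and> 0 \<notin> set bs \<and>
      Gcd (set as \<union> set bs) = 1 \<and> path_ok (2 * hd0 bs) as \<and> path_ok (2 * hd0 as) bs"
    unfolding P_structure_def arithmetical_structure_def P_graph_def fst_conv snd_conv
      multigraph.simps pos dvd img by simp
  moreover have "P_structure m n (as, bs) \<Longrightarrow> length as = m \<and> length bs = n"
    by (simp add: P_structure_def)
  ultimately show ?thesis by blast
qed

section \<open>Smoothing as deletion of a peak\<close>

lemma smooth_path_Cons: "smooth_path xs ys \<Longrightarrow> smooth_path (a # xs) (a # ys)"
proof (induction rule: smooth_path.induct)
  case (last xs c)
  show ?case using smooth_path.last[of "a # xs" c] by simp
next
  case (inner b a' c xs ys)
  then show ?case using smooth_path.inner[of b a' c "a # xs" ys] by simp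
qed

text \<open>The trailing 0 merges the two operations: for empty \<open>s\<close> the peak
  \<open>a + hd0 s\<close> is a repeated last entry \<open>a\<close>, otherwise it is the sum of its
  two neighbours.\<close>

lemma smooth_path_peak: "smooth_path (a # (a + hd0 s) # s) (a # s)"
proof (cases s)
  case Nil
  then show ?thesis using smooth_path.last[of "[]" a] by simp
next
  case (Cons c s')
  then show ?thesis using smooth_path.inner[of "a + c" a c "[]" s'] by simp
qed

lemma smooth_path_cases_peak:
  assumes "smooth_path xs ys"
  obtains us a s where "xs = us @ a # (a + hd0 s) # s" "ys = us @ a # s"
  using assms
proof cases
  case (last us c)
  then show ?thesis using that[of us c "[]"] by simp
next
  case (inner b a c us s)
  then show ?thesis using that[of us a "c # s"] by simp
qed

text \<open>The first entry survives, so the deleted peak either stands right behind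
  \<open>s\<close> or is deleted within the tail.\<close>

lemma smooth_path_into_Cons:
  assumes "smooth_path T (s # T1)"
  obtains T' where "T = s # T'" "smooth_path T' T1"
    | "T = s # (s + hd0 T1) # T1"
  using assms
proof (cases rule: smooth_path_cases_peak)
  case (1 us a r)
  show ?thesis
  proof (cases us)
    case Nil
    then show ?thesis using 1 that(2) by auto
  next
    case (Cons u us')
    have "smooth_path (us' @ a # (a + hd0 r) # r) (us' @ a # r)"
      by (induction us') (auto intro: smooth_path_Cons smooth_path_peak)
    then show ?thesis using 1 Cons that(1) by auto
  qed
qed

lemma smooth_path_length: "smooth_path xs ys \<Longrightarrow> length xs = Suc (length ys)"
  by (elim smooth_path_cases_peak) simp

lemma smooth_path_not_Nil: "smooth_path xs ys \<Longrightarrow> xs \<noteq> [] \<and> ys \<noteq> []"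
  by (elim smooth_path_cases_peak) simp

lemma smooth_path_hd0: "smooth_path xs ys \<Longrightarrow> hd0 xs = hd0 ys"
  by (elim smooth_path_cases_peak) (simp add: hd0_append)

text \<open>The second entry changes only if it is the deleted peak \<open>a + hd0 s\<close>, and
  then \<open>hd0 s\<close> takes its place.\<close>

lemma smooth_path_hd0_tl: "smooth_path xs ys \<Longrightarrow> hd0 (tl ys) \<le> hd0 (tl xs)"
proof (elim smooth_path_cases_peak)
  fix us a s
  assume "xs = us @ a # (a + hd0 s) # s" "ys = us @ a # s"
  then show ?thesis by (cases us) (auto simp: hd0_append)
qed

lemma path_ok_add_hd0: "path_ok (x + hd0 s) s \<longleftrightarrow> path_ok x s"
proof (cases s)
  case (Cons c r)
  have "c dvd x + c + hd0 r \<longleftrightarrow> c dvd x + hd0 r"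
    by (metis add.assoc add.commute dvd_add_triv_left_iff)
  then show ?thesis using Cons by simp
qed simp

text \<open>The peak divides the sum of its neighbours because it equals that sum. Deleting it
  changes the neighbour sum of each of its neighbours by that neighbour's own label, which does not
  affect divisibility.\<close>

lemma path_ok_peak: "path_ok p (us @ a # (a + hd0 s) # s) \<longleftrightarrow> path_ok p (us @ a # s)"
proof (induction us arbitrary: p)
  case Nil
  have "a dvd p + (a + hd0 s) \<longleftrightarrow> a dvd p + hd0 s"
    by (metis add.left_commute dvd_add_triv_left_iff)
  then show ?case by (simp add: path_ok_add_hd0)
qed (auto simp: hd0_append)

lemma smooth_path_path_ok: "smooth_path xs ys \<Longrightarrow> path_ok p xs \<longleftrightarrow> path_ok p ys"
  by (elim smooth_path_cases_peak) (simp add: path_ok_peak)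

lemma smooth_path_pos: "smooth_path xs ys \<Longrightarrow> 0 \<notin> set xs \<longleftrightarrow> 0 \<notin> set ys"
  by (elim smooth_path_cases_peak) auto

text \<open>The deleted entry repeats a remaining entry or is the sum of two, so common divisors are
  unchanged. The set \<open>M\<close> will hold the labels of the other path.\<close>

lemma smooth_path_Gcd:
  assumes "smooth_path xs ys"
  shows "Gcd (set xs \<union> M) = Gcd (set ys \<union> M)"
  using assms
proof (cases rule: smooth_path_cases_peak)
  case (1 us a s)
  have "a + hd0 s = a \<or> hd0 s \<in> set s" by (cases s) auto
  then have "Gcd (insert (a + hd0 s) (set ys \<union> M)) = Gcd (set ys \<union> M)"
  proof
    assume "hd0 s \<in> set s"
    then have "Gcd (set ys \<union> M) dvd a + hd0 s"
      unfolding 1 by (intro dvd_add Gcd_dvd) auto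
    then show ?thesis by (simp add: gcd_proj2_iff)
  qed (simp add: 1 insert_absorb)
  moreover have "set xs = insert (a + hd0 s) (set ys)" using 1 by auto
  ultimately show ?thesis by simp
qed

text \<open>First labels are kept, so the condition on the other path is untouched. Both directions
  matter: ancestors of structures are structures, and for the count so are descendants.\<close>

lemma smoothing_P_structure:
  assumes "smoothing T T'"
  shows "P_structure (length (fst T)) (length (snd T)) T \<longleftrightarrow>
         P_structure (length (fst T')) (length (snd T')) T'"
  using assms
proof cases
  case (1 as as' bs)
  then show ?thesis
    by (simp add: P_structure_iff smooth_path_hd0[of as as'] smooth_path_path_ok[of as as']
        smooth_path_pos[of as as'] smooth_path_Gcd[of as as'])
next
  case (2 bs bs' as)
  then show ?thesis
    by (simp add: P_structure_iff smooth_path_hd0[of bs bs'] smooth_path_path_ok[of bs bs']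
        smooth_path_pos[of bs bs'] smooth_path_Gcd[of bs bs'] Un_commute[of "set as"])
qed

section \<open>Sequences of smoothing steps\<close>

lemma ancestor_P_structure:
  assumes "ancestor S T"
  shows "P_structure (length (fst T)) (length (snd T)) T \<longleftrightarrow>
         P_structure (length (fst S)) (length (snd S)) S"
  using assms unfolding ancestor_def
  by (induction rule: converse_rtranclp_induct) (simp_all add: smoothing_P_structure)

text \<open>Steps on different paths are independent, so those on the first path may all be done
  before those on the second.\<close>

lemma ancestor_iff:
  "ancestor (as', bs') (as, bs) \<longleftrightarrow> smooth_path\<^sup>*\<^sup>* as as' \<and> smooth_path\<^sup>*\<^sup>* bs bs'"
proof
  have "smoothing\<^sup>*\<^sup>* T S \<Longrightarrow> smooth_path\<^sup>*\<^sup>* (fst T) (fst S) \<and> smooth_path\<^sup>*\<^sup>* (snd T) (snd S)" for S T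
  proof (induction rule: rtranclp_induct)
    case (step S S')
    then show ?case by (auto elim!: smoothing.cases intro: rtranclp.rtrancl_into_rtrancl)
  qed simp
  then show "ancestor (as', bs') (as, bs) \<Longrightarrow> smooth_path\<^sup>*\<^sup>* as as' \<and> smooth_path\<^sup>*\<^sup>* bs bs'"
    unfolding ancestor_def by force
next
  assume *: "smooth_path\<^sup>*\<^sup>* as as' \<and> smooth_path\<^sup>*\<^sup>* bs bs'"
  have "smoothing\<^sup>*\<^sup>* (as, bs) (as', bs)" using conjunct1[OF *]
    by induction (auto intro: rtranclp.rtrancl_into_rtrancl smoothing.intros)
  also have "smoothing\<^sup>*\<^sup>* (as', bs) (as', bs')" using conjunct2[OF *]
    by induction (auto intro: rtranclp.rtrancl_into_rtrancl smoothing.intros)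
  finally show "ancestor (as', bs') (as, bs)" unfolding ancestor_def .
qed

lemma smooth_paths_Cons: "smooth_path\<^sup>*\<^sup>* xs ys \<Longrightarrow> smooth_path\<^sup>*\<^sup>* (a # xs) (a # ys)"
  by (induction rule: rtranclp_induct)
    (auto intro: rtranclp.rtrancl_into_rtrancl smooth_path_Cons)

lemma smooth_paths_hd0: "smooth_path\<^sup>*\<^sup>* xs ys \<Longrightarrow> hd0 xs = hd0 ys"
  by (induction rule: rtranclp_induct) (auto simp: smooth_path_hd0)

lemma smooth_paths_hd0_tl: "smooth_path\<^sup>*\<^sup>* xs ys \<Longrightarrow> hd0 (tl ys) \<le> hd0 (tl xs)"
  by (induction rule: rtranclp_induct) (auto dest: smooth_path_hd0_tl)

lemma smooth_paths_length: "smooth_path\<^sup>*\<^sup>* xs ys \<Longrightarrow> xs = ys \<or> length ys < length xs"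
  by (induction rule: rtranclp_induct) (auto dest: smooth_path_length)

lemma smooth_paths_Nil: "smooth_path\<^sup>*\<^sup>* xs ys \<Longrightarrow> xs = [] \<longleftrightarrow> ys = []"
  by (induction rule: rtranclp_induct) (auto dest: smooth_path_not_Nil)

section \<open>Normal form of a path\<close>

fun push :: "nat \<Rightarrow> nat list \<Rightarrow> nat list" where
  "push x [] = [x]"
| "push x (b # s) = (if b = x + hd0 s then push x s else x # b # s)"

text \<open>The list is read from right to left. The stack holds the smoothed part, and
  \<open>push x\<close> removes its top as long as that is a peak between \<open>x\<close> and the
  entry below.\<close>

definition smooth_form :: "nat list \<Rightarrow> nat list" where
  "smooth_form xs = foldr push xs []"

lemma smooth_form_simps [simp]:
  "smooth_form [] = []" "smooth_form (x # xs) = push x (smooth_form xs)"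
  by (simp_all add: smooth_form_def)

lemma hd0_push [simp]: "hd0 (push x s) = x"
  by (induction x s rule: push.induct) auto

lemma hd0_smooth_form [simp]: "hd0 (smooth_form xs) = hd0 xs"
  by (cases xs) auto

lemma push_smooth_paths: "smooth_path\<^sup>*\<^sup>* (x # s) (push x s)"
  by (induction x s rule: push.induct)
    (auto intro: converse_rtranclp_into_rtranclp smooth_path_peak)

lemma smooth_form_smooth_paths: "smooth_path\<^sup>*\<^sup>* xs (smooth_form xs)"
  by (induction xs) (auto intro: rtranclp_trans smooth_paths_Cons push_smooth_paths)

text \<open>Suppose the top \<open>b\<close> is not a peak but \<open>b \<ge> x\<close>. Since
  \<open>b\<close> divides \<open>x + hd0 s\<close> and \<open>hd0 s < b\<close>, the quotient is 0
  or 1; 0 contradicts \<open>0 < x\<close>, and 1 makes \<open>b\<close> a peak. Hence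
  \<open>b < x\<close> whenever \<open>push\<close> stops at \<open>b\<close>.\<close>

lemma push_decreasing:
  assumes "path_ok x s" "0 < x" "0 \<notin> set s" "sorted_wrt (>) s"
  shows "sorted_wrt (>) (push x s)"
  using assms
proof (induction x s rule: push.induct)
  case (2 x b s)
  show ?case
  proof (cases "b = x + hd0 s")
    case True
    then have "path_ok x s" using 2(2) by (simp add: path_ok_add_hd0)
    then show ?thesis using 2 True by simp
  next
    case False
    have "b > hd0 s" using 2 by (cases s) auto
    have "b < x"
    proof (rule ccontr)
      assume "\<not> b < x"
      moreover obtain k where k: "x + hd0 s = b * k" using 2(2) by (auto elim: dvdE)
      ultimately have "b * k < b * 2" using \<open>b > hd0 s\<close> by linarith
      then have "k = 0 \<or> k = 1" by (auto simp: less_2_cases_iff)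
      then show False using k False 2(3) by auto
    qed
    then show ?thesis using False 2 by auto
  qed
qed simp

lemma smooth_paths_pos: "smooth_path\<^sup>*\<^sup>* xs ys \<Longrightarrow> 0 \<notin> set xs \<longleftrightarrow> 0 \<notin> set ys"
  by (induction rule: rtranclp_induct) (simp_all add: smooth_path_pos)

lemma smooth_paths_path_ok: "smooth_path\<^sup>*\<^sup>* xs ys \<Longrightarrow> path_ok p xs \<longleftrightarrow> path_ok p ys"
  by (induction rule: rtranclp_induct) (simp_all add: smooth_path_path_ok)

lemma smooth_form_decreasing:
  "path_ok p xs \<Longrightarrow> 0 \<notin> set xs \<Longrightarrow> sorted_wrt (>) (smooth_form xs)"
proof (induction xs arbitrary: p)
  case (Cons x xs)
  moreover have "path_ok x (smooth_form xs)" "0 \<notin> set (smooth_form xs)"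
    using Cons.prems smooth_form_smooth_paths[of xs]
    by (auto simp: smooth_paths_path_ok smooth_paths_pos)
  ultimately show ?case by (auto intro: push_decreasing)
qed simp

text \<open>The stack for \<open>s\<close> has top \<open>hd0 s\<close>, which is less than
  \<open>a + hd0 s\<close> and hence no peak below it. So \<open>a + hd0 s\<close> just lands on
  top, and pushing \<open>a\<close> removes it again.\<close>

lemma push_peak:
  assumes "0 < a"
  shows "push a (push (a + hd0 s) (smooth_form s)) = push a (smooth_form s)"
proof (cases s)
  case (Cons c s')
  have "smooth_form s \<noteq> []" "hd0 (smooth_form s) = c"
    using smooth_paths_Nil[OF smooth_form_smooth_paths[of s]] Cons by auto
  then obtain r where "smooth_form s = c # r"
    by (cases "smooth_form s") auto
  then show ?thesis using Cons assms by auto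
qed simp

lemma smooth_form_smooth_path:
  assumes "smooth_path xs ys" "0 \<notin> set ys"
  shows "smooth_form xs = smooth_form ys"
  using assms(1)
proof (cases rule: smooth_path_cases_peak)
  case (1 us a s)
  moreover from this have "smooth_form (a # (a + hd0 s) # s) = smooth_form (a # s)"
    using assms(2) push_peak[of a s] by auto
  \<comment> \<open>The common prefix \<open>us\<close> is pushed onto equal stacks.\<close>
  ultimately show ?thesis by (simp add: smooth_form_def)
qed

lemma smooth_form_smooth_paths_eq:
  "smooth_path\<^sup>*\<^sup>* xs ys \<Longrightarrow> 0 \<notin> set ys \<Longrightarrow> smooth_form xs = smooth_form ys"
  by (induction rule: converse_rtranclp_induct)
    (auto simp: smooth_form_smooth_path smooth_paths_pos)

text \<open>A top smaller than \<open>x\<close> cannot equal \<open>x\<close> plus another entry, so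
  nothing is removed.\<close>

lemma push_decreasing_id: "sorted_wrt (>) (x # s) \<Longrightarrow> push x s = x # s"
  by (cases s) auto

lemma smooth_form_decreasing_id: "sorted_wrt (>) xs \<Longrightarrow> smooth_form xs = xs"
  by (induction xs) (auto simp: push_decreasing_id)

section \<open>Counting the lists that smooth to a given list\<close>

definition smooth_path_descendants :: "nat list \<Rightarrow> nat \<Rightarrow> nat list set" where
  "smooth_path_descendants S n = {T. length T = n \<and> smooth_path\<^sup>*\<^sup>* T S}"

text \<open>If no step deletes the entry right behind \<open>s\<close>, all steps act on the tail.
  Otherwise the last such deletion can be postponed to the very end, where the deleted entry is
  \<open>s + hd0 S\<close>.\<close>

lemma smooth_paths_to_Cons_iff:
  "smooth_path\<^sup>*\<^sup>* T (s # S) \<longleftrightarrow>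
     (\<exists>T'. T = s # T' \<and> smooth_path\<^sup>*\<^sup>* T' S) \<or> smooth_path\<^sup>*\<^sup>* T (s # (s + hd0 S) # S)"
proof
  assume "smooth_path\<^sup>*\<^sup>* T (s # S)"
  then show "(\<exists>T'. T = s # T' \<and> smooth_path\<^sup>*\<^sup>* T' S) \<or> smooth_path\<^sup>*\<^sup>* T (s # (s + hd0 S) # S)"
  proof (induction rule: converse_rtranclp_induct)
    case (step T T1)
    from step.IH show ?case
    proof
      assume "\<exists>T'. T1 = s # T' \<and> smooth_path\<^sup>*\<^sup>* T' S"
      then obtain T1' where T1: "T1 = s # T1'" "smooth_path\<^sup>*\<^sup>* T1' S" by blast
      from step.hyps(1)[unfolded T1(1)] show ?case
      proof (cases rule: smooth_path_into_Cons)
        case (1 T')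
        then have "smooth_path\<^sup>*\<^sup>* T' S" using T1 by simp
        then show ?thesis using 1 by simp
      next
        case 2
        \<comment> \<open>Smoothing \<open>T1'\<close> to \<open>S\<close> behind the peak keeps its
          first entry, so the peak \<open>s + hd0 T1'\<close> is already
          \<open>s + hd0 S\<close>.\<close>
        then show ?thesis using T1 by (simp add: smooth_paths_Cons smooth_paths_hd0)
      qed
    qed (meson step.hyps(1) converse_rtranclp_into_rtranclp)
  qed simp
qed (auto intro: smooth_paths_Cons rtranclp.rtrancl_into_rtrancl smooth_path_peak)

lemma smooth_path_descendants_Cons:
  "smooth_path_descendants (s # S) (Suc n) =
     Cons s ` smooth_path_descendants S n \<union>
     smooth_path_descendants (s # (s + hd0 S) # S) (Suc n)"
  unfolding smooth_path_descendants_def by (subst smooth_paths_to_Cons_iff) auto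

text \<open>The second entry, read as 0 if absent, equals \<open>hd0 S\<close> in the first set and
  is at least \<open>s + hd0 S\<close> in the second.\<close>

lemma smooth_path_descendants_disjoint:
  assumes "0 < s"
  shows "Cons s ` smooth_path_descendants S n \<inter>
         smooth_path_descendants (s # (s + hd0 S) # S) k = {}"
  using assms
  by (force simp: smooth_path_descendants_def dest: smooth_paths_hd0 smooth_paths_hd0_tl)

lemma C_diag: "n > 0 \<Longrightarrow> C n n = 1"
  by (simp add: C_def flip: mult_2)

text \<open>With \<open>N = 2 * n - k\<close> the binomials are \<open>Suc N choose n\<close>,
  \<open>N choose (n - 1)\<close> and \<open>N choose n\<close>. Absorption and Pascal's rule make
  each a multiple of one quantity \<open>X\<close>, leaving an identity of rational functions in
  \<open>n\<close> and \<open>k\<close>.\<close>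

lemma C_rec:
  assumes "1 \<le> k" "k < Suc n"
  shows "C (Suc n) k = C n (k - 1) + C (Suc n) (Suc k)"
proof -
  obtain j where j: "n = Suc j" using assms by (cases n) auto
  define N where "N = 2 * n - k"
  have N: "2 * Suc n - k - 1 = Suc N" "2 * n - (k - 1) - 1 = N" "2 * Suc n - Suc k - 1 = N"
    using assms by (auto simp: N_def)
  have *: "Suc j * (N choose Suc j) = (N - j) * (N choose j)"
    by (metis binomial_absorb_comp binomial_absorption mult.commute)
  define X where "X = real (N choose j) / real (Suc j)"
  have Nj: "real (N - j) = real (Suc n) - real k"
    using assms by (simp add: N_def j of_nat_diff)
  have X1: "real (N choose j) = real n * X" by (simp add: X_def j)
  have X2: "real (N choose n) = (real (Suc n) - real k) * X"
    using arg_cong[OF *, of real] unfolding of_nat_mult Nj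
    by (simp add: X_def j field_simps)
  have X3: "real (Suc N choose n) = (2 * real n + 1 - real k) * X"
    using X1 X2 by (simp add: j algebra_simps)
  have c1: "C (Suc n) k = real k / real (Suc n) * ((2 * real n + 1 - real k) * X)"
    unfolding C_def N using X3 by simp
  have c2: "C n (k - 1) = (real k - 1) * X"
    unfolding C_def N using X1 assms j by (simp add: of_nat_diff)
  have c3: "C (Suc n) (Suc k) = (real k + 1) / real (Suc n) * ((real (Suc n) - real k) * X)"
    unfolding C_def N using X2 by (simp add: add.commute)
  show ?thesis unfolding c1 c2 c3 by (simp add: field_simps)
qed

text \<open>The measure \<open>2 * n - length S\<close> drops by one in both branches of the
  recurrence: once \<open>n\<close> and the target both shrink by one, once the target grows by one.
  Empty targets are included because the first branch reaches them.\<close>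

lemma card_smooth_path_descendants:
  assumes "0 \<notin> set S" "length S \<le> n" "0 < n"
  shows "finite (smooth_path_descendants S n) \<and>
         real (card (smooth_path_descendants S n)) = C n (length S)"
  using assms
proof (induction "2 * n - length S" arbitrary: n S rule: less_induct)
  case less
  show ?case
  proof (cases "length S = n")
    case True
    then have "smooth_path_descendants S n = {S}"
      by (auto simp: smooth_path_descendants_def dest: smooth_paths_length)
    then show ?thesis using True less.prems by (simp add: C_diag)
  next
    case False
    show ?thesis
    proof (cases S)
      case Nil
      then have "smooth_path_descendants S n = {}"
        using less.prems by (auto simp: smooth_path_descendants_def dest: smooth_paths_Nil)
      then show ?thesis using Nil by (simp add: C_def)
    next
      case (Cons s S')
      obtain n' where n: "n = Suc n'" using less.prems by (cases n) auto
      let ?X = "smooth_path_descendants S' n'"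
      let ?Y = "smooth_path_descendants (s # (s + hd0 S') # S') n"
      \<comment> \<open>Strictness ensures \<open>0 < n'\<close> in the first branch and leaves room
        for the longer target in the second.\<close>
      have len: "length S' < n'" using False less.prems Cons n by simp
      have s: "0 < s" using less.prems Cons by simp
      have X: "finite ?X \<and> real (card ?X) = C n' (length S')"
        using less.prems len by (intro less.hyps) (auto simp: Cons n)
      have Y: "finite ?Y \<and> real (card ?Y) = C n (length (s # (s + hd0 S') # S'))"
        using less.prems len s by (intro less.hyps) (auto simp: Cons n)
      have eq: "smooth_path_descendants S n = Cons s ` ?X \<union> ?Y"
        unfolding Cons n by (rule smooth_path_descendants_Cons)
      have "card (smooth_path_descendants S n) = card ?X + card ?Y"
        unfolding eq using X Y smooth_path_descendants_disjoint[OF s]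
        by (subst card_Un_disjoint) (auto simp: card_image)
      moreover have "C n (length S) = C n' (length S') + C n (Suc (length S))"
        using C_rec[of "length S" n'] len by (simp add: Cons n)
      ultimately show ?thesis using X Y eq by (simp add: Cons)
    qed
  qed
qed

section \<open>Smooth ancestors and descendants of structures\<close>

lemma P_structure_lengths: "P_structure m n T \<Longrightarrow> length (fst T) = m \<and> length (snd T) = n"
  by (simp add: P_structure_def)

lemma ex1_smooth_ancestor:
  assumes "m \<ge> 1" "n \<ge> 1" "P_structure m n T"
  shows "\<exists>!S. ancestor S T \<and> smooth S \<and>
           (\<exists>m' n'. 1 \<le> m' \<and> m' \<le> m \<and> 1 \<le> n' \<and> n' \<le> n \<and> P_structure m' n' S)"
proof -
  obtain as bs where T: "T = (as, bs)" by (cases T)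
  let ?S = "(smooth_form as, smooth_form bs)"
  note str = assms(3)[unfolded T P_structure_iff]
  have anc: "ancestor ?S T" by (simp add: T ancestor_iff smooth_form_smooth_paths)
  have sm: "smooth ?S" using str by (auto simp: smooth_def intro: smooth_form_decreasing)
  have "P_structure (length (smooth_form as)) (length (smooth_form bs)) ?S"
    using ancestor_P_structure[OF anc] assms(3) P_structure_lengths[OF assms(3)] by simp
  moreover have "1 \<le> length (smooth_form xs) \<and> length (smooth_form xs) \<le> length xs"
    if "1 \<le> length xs" for xs
  proof
    show "1 \<le> length (smooth_form xs)"
      using smooth_paths_Nil[OF smooth_form_smooth_paths[of xs]] that
      by (cases "smooth_form xs") auto
    show "length (smooth_form xs) \<le> length xs"
      using smooth_paths_length[OF smooth_form_smooth_paths[of xs]] by auto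
  qed
  ultimately have "\<exists>m' n'. 1 \<le> m' \<and> m' \<le> m \<and> 1 \<le> n' \<and> n' \<le> n \<and> P_structure m' n' ?S"
    using str assms by blast
  \<comment> \<open>A smooth ancestor is its own normal form, and normal forms are constant along
    smoothing sequences.\<close>
  moreover have "S = ?S" if S: "ancestor S T" "smooth S" for S
  proof -
    obtain as' bs' where S': "S = (as', bs')" by (cases S)
    have "smooth_form as = smooth_form as'" "smooth_form bs = smooth_form bs'"
      using S str by (auto simp: T S' ancestor_iff smooth_paths_pos
          intro: smooth_form_smooth_paths_eq)
    then show ?thesis using S by (simp add: S' smooth_def smooth_form_decreasing_id)
  qed
  ultimately show ?thesis using anc sm by blast
qed

text \<open>Every labelling that smooths to a structure is itself a structure, so only the lengths
  remain to be prescribed and the two paths vary independently.\<close>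

lemma descendants_P_structure:
  assumes "P_structure m' n' S"
  shows "{T. P_structure m n T \<and> ancestor S T} =
         smooth_path_descendants (fst S) m \<times> smooth_path_descendants (snd S) n"
proof -
  have "P_structure m n T \<longleftrightarrow> length (fst T) = m \<and> length (snd T) = n" if "ancestor S T" for T
    using ancestor_P_structure[OF that] assms P_structure_lengths by metis
  moreover have "ancestor S T \<longleftrightarrow>
      smooth_path\<^sup>*\<^sup>* (fst T) (fst S) \<and> smooth_path\<^sup>*\<^sup>* (snd T) (snd S)" for T
    using ancestor_iff by (cases S; cases T) simp
  ultimately show ?thesis
    by (auto simp: smooth_path_descendants_def)
qed

lemma card_descendants_P_structure:
  assumes "1 \<le> m'" "m' \<le> m" "1 \<le> n'" "n' \<le> n" "P_structure m' n' S"
  shows "finite {T. P_structure m n T \<and> ancestor S T} \<and>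
         real (card {T. P_structure m n T \<and> ancestor S T}) = C m m' * C n n'"
proof -
  obtain as bs where S: "S = (as, bs)" by (cases S)
  have "0 \<notin> set as" "length as = m'" "0 \<notin> set bs" "length bs = n'"
    using assms by (simp_all add: S P_structure_iff)
  then show ?thesis
    using assms(1-4) card_smooth_path_descendants[of as m] card_smooth_path_descendants[of bs n]
    unfolding descendants_P_structure[OF assms(5)] by (simp add: S card_cartesian_product)
qed

theorem theorem2p2:
  fixes m n :: nat
  assumes "m \<ge> 1" and "n \<ge> 1"
  shows "(\<forall>T. P_structure m n T \<longrightarrow>
            (\<exists>!S. ancestor S T \<and> smooth S \<and>
                  (\<exists>m' n'. 1 \<le> m' \<and> m' \<le> m \<and> 1 \<le> n' \<and> n' \<le> n \<and> P_structure m' n' S))) \<and>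
         (\<forall>m' n' S. 1 \<le> m' \<and> m' \<le> m \<and> 1 \<le> n' \<and> n' \<le> n \<and> P_structure m' n' S \<and> smooth S \<longrightarrow>
            finite {T. P_structure m n T \<and> ancestor S T} \<and>
            real (card {T. P_structure m n T \<and> ancestor S T}) = C m m' * C n n')"
  by (intro conjI allI impI; (elim conjE)?)
    (simp_all only: ex1_smooth_ancestor[OF assms] card_descendants_P_structure)

end
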